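(* Let $n \ge 1$ be an integer and let $S$ be any set of $2n+1$ points in the Euclidean plane in general position. Then $S$ has exactly $n^2$ point-splitting circles.
   Context: A finite set $S$ of points in the Euclidean plane is in general position if no three points of $S$ are collinear and no four points of $S$ are concyclic (lie on a common circle). For a set $S$ of $2n+1$ points in general position, a circle is called point-splitting for $S$ if it has exactly 3 points of $S$ on its circumference, exactly $n-1$ points of $S$ in its interior (the open disk it bounds), and exactly $n-1$ points of $S$ in its exterior. *)

theory Defs
  imports "HOL-Analysis.Analysis"
begin

definition concyclic :: "(real^2) set \<Rightarrow> bool" where
  "concyclic T \<longleftrightarrow> (\<exists>c r. r > 0 \<and> T \<subseteq> sphere c r)"

definition general_position :: "(real^2) set \<Rightarrow> bool" where
  "general_position S \<longleftrightarrow> finite S \<and>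
     (\<forall>T\<subseteq>S. card T = 3 \<longrightarrow> \<not> collinear T) \<and>
     (\<forall>T\<subseteq>S. card T = 4 \<longrightarrow> \<not> concyclic T)"

text \<open>A circle is represented by its point set \<open>C\<close>, so that circles can be counted as sets;
  its centre and (positive) radius are determined by \<open>C\<close>. The set \<open>S\<close> is meant to have
  \<open>2 * n + 1\<close> points, \<open>n \<ge> 1\<close>; for \<open>n = 0\<close> the subtraction \<open>n - 1\<close> would be truncated.\<close>

definition point_splitting :: "nat \<Rightarrow> (real^2) set \<Rightarrow> (real^2) set \<Rightarrow> bool" where
  "point_splitting n S C \<longleftrightarrow>
     (\<exists>c r. r > 0 \<and> C = sphere c r \<and>
        card (S \<inter> sphere c r) = 3 \<and>
        card (S \<inter> ball c r) = n - 1 \<and>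
        card (S - cball c r) = n - 1)"

end

theory Submission
  imports Defs
begin

text \<open>
  Fix a linear functional, called the height, that takes distinct values on \<open>S\<close>. Every
  point-splitting circle passes through three points of \<open>S\<close> and so has a unique middle point
  \<open>v\<close> with respect to height. The circles are counted separately for each \<open>v\<close>: if
  \<open>k\<close> points of \<open>S\<close> are lower than \<open>v\<close> (and hence \<open>2 * n - k\<close> are higher), then
  exactly \<open>min k (2 * n - k)\<close> point-splitting circles have middle point \<open>v\<close>
  (\<open>card_halving_pairs\<close>). Summing over \<open>k = 0, \<dots>, 2 * n\<close> gives \<open>n\<^sup>2\<close>
  (\<open>sum_min_symmetric\<close>).

  To find the number for one \<open>v\<close>, invert the plane at \<open>v\<close>. Circles through \<open>v\<close> become
  lines, interior and exterior become the two open half-planes (\<open>circle_as_line\<close>), general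
  position means that no three of the \<open>2 * n\<close> image points lie on a line, and the sign of the
  height relative to \<open>v\<close> is kept. A circle with middle point \<open>v\<close> is thus a line that joins an
  image point lower than \<open>v\<close> to one higher than \<open>v\<close>; the circle is
  point-splitting iff this line halves the other image points.

  The remaining planar fact, that exactly \<open>min a b\<close> halving lines join the \<open>a\<close> points below
  to the \<open>b\<close> points above, is an exact form of a lemma of Lovasz. It is proved by a sweep
  (\<open>card_middle_crossings\<close>). Project the points along a direction of slope parameter \<open>m\<close> onto
  the line of constant height through \<open>v\<close>: the projection of \<open>(s, u)\<close> is \<open>s - m * u\<close>, so as
  \<open>m\<close> runs through the reals every point becomes a particle with constant velocity
  \<open>- u\<close>, two particles meet exactly when the line joining the points has the current
  direction, and the line is halving iff the meeting takes place in the middle of the row of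
  particles. Count the particles with \<open>u < 0\<close>, which move to the right, in the left half of the
  row. This count can change only at a meeting in the middle, where it drops by one if the two
  velocities have opposite signs and is unchanged otherwise. Long before all meetings the
  right-movers form the left end of the row and the count is \<open>min a n\<close>; long after them they
  form the right end and the count is \<open>min a (n - b)\<close> (truncated). As \<open>a + b = 2 * n\<close>, the
  difference is \<open>min a b\<close>.
\<close>

section \<open>Ranks\<close>

definition rank_of :: "'i set \<Rightarrow> ('i \<Rightarrow> real) \<Rightarrow> 'i \<Rightarrow> nat" where
  "rank_of P f i = card {j \<in> P. f j < f i}"

lemma bij_betw_rank_of:
  assumes "finite A" "inj_on f A"
  shows "bij_betw (rank_of A f) A {..<card A}"
proof -
  have less: "rank_of A f i < rank_of A f j" if "i \<in> A" "j \<in> A" "f i < f j" for i j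
    unfolding rank_of_def
  proof (rule psubset_card_mono)
    show "finite {k \<in> A. f k < f j}" using assms(1) by simp
    show "{k \<in> A. f k < f i} \<subset> {k \<in> A. f k < f j}" using that by force
  qed
  have inj: "inj_on (rank_of A f) A"
  proof (rule inj_onI)
    fix i j assume ij: "i \<in> A" "j \<in> A" "rank_of A f i = rank_of A f j"
    have "\<not> f i < f j" "\<not> f j < f i" using less[of i j] less[of j i] ij by auto
    then show "i = j" using assms(2) ij by (simp add: inj_on_def)
  qed
  have sub: "rank_of A f ` A \<subseteq> {..<card A}"
  proof
    fix k assume "k \<in> rank_of A f ` A"
    then obtain i where i: "i \<in> A" "k = card {j \<in> A. f j < f i}" by (auto simp: rank_of_def)
    have "{j \<in> A. f j < f i} \<subset> A" using i by auto
    then show "k \<in> {..<card A}" using i assms(1) psubset_card_mono by auto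
  qed
  have "rank_of A f ` A = {..<card A}"
    by (rule card_subset_eq) (auto simp: sub card_image[OF inj] intro: sub[THEN subsetD])
  then show ?thesis using inj by (simp add: bij_betw_def)
qed

lemma card_rank_of_less:
  assumes "finite A" "inj_on f A"
  shows "card {i \<in> A. rank_of A f i < k} = min (card A) k"
proof -
  have b: "bij_betw (rank_of A f) A {..<card A}" by (rule bij_betw_rank_of[OF assms])
  have "rank_of A f ` {i \<in> A. rank_of A f i < k} = rank_of A f ` A \<inter> {..<k}" by auto
  also have "\<dots> = {..<min (card A) k}" using bij_betw_imp_surj_on[OF b] by auto
  finally have "rank_of A f ` {i \<in> A. rank_of A f i < k} = {..<min (card A) k}" .
  moreover have "inj_on (rank_of A f) {i \<in> A. rank_of A f i < k}"
    using bij_betw_imp_inj_on[OF b] by (rule inj_on_subset) auto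
  ultimately show ?thesis using card_image[of "rank_of A f"] by fastforce
qed

lemma sum_rank_of:
  fixes g :: "nat \<Rightarrow> nat"
  assumes "finite A" "inj_on f A"
  shows "(\<Sum>i\<in>A. g (rank_of A f i)) = (\<Sum>k<card A. g k)"
  using sum.reindex_bij_betw[OF bij_betw_rank_of[OF assms]] .

lemma sum_min_symmetric: "(\<Sum>k<2 * n + 1. min k (2 * n - k)) = n\<^sup>2" for n :: nat
proof (induction n)
  case (Suc n)
  have "(\<Sum>k<2 * Suc n + 1. min k (2 * Suc n - k))
      = (\<Sum>k<2 * n + 1. min (Suc k) (2 * Suc n - Suc k))"
    using sum.lessThan_Suc_shift[of "\<lambda>k. min k (2 * Suc n - k)" "2 * n + 2"] by simp
  also have "\<dots> = (\<Sum>k<2 * n + 1. min k (2 * n - k) + 1)"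
    by (rule sum.cong) auto
  also have "\<dots> = n\<^sup>2 + (2 * n + 1)" using Suc by (simp only: sum.distrib) simp
  finally show ?case by (simp add: power2_eq_square)
qed simp

section \<open>Particles moving on a line\<close>

text \<open>
  Particle \<open>i\<close> is at \<open>s i - m * u i\<close> at time \<open>m\<close>. The assumptions on \<open>(s, u)\<close> say,
  for the points with these coordinates, that they are distinct, off the axis \<open>u = 0\<close>, and that
  no non-horizontal line contains three of them.
\<close>

locale particles =
  fixes P :: "'i set" and s u :: "'i \<Rightarrow> real"
  assumes fin: "finite P"
    and distinct: "\<lbrakk>i \<in> P; j \<in> P; i \<noteq> j; u i = u j\<rbrakk> \<Longrightarrow> s i \<noteq> s j"
    and no_triple: "\<lbrakk>i \<in> P; j \<in> P; k \<in> P; i \<noteq> j; j \<noteq> k; i \<noteq> k;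
       s i - m * u i = s j - m * u j\<rbrakk> \<Longrightarrow> s k - m * u k \<noteq> s j - m * u j"
    and nonzero: "i \<in> P \<Longrightarrow> u i \<noteq> 0"
begin

definition pos :: "real \<Rightarrow> 'i \<Rightarrow> real" where
  "pos m i = s i - m * u i"

definition meets :: "real set" where
  "meets = {m. \<exists>i\<in>P. \<exists>j\<in>P. i \<noteq> j \<and> pos m i = pos m j}"

text \<open>For \<open>2 * n\<close> particles and a time \<open>m\<close> without meetings this is the left half of the row.\<close>

definition first_ranks :: "nat \<Rightarrow> real \<Rightarrow> 'i set" where
  "first_ranks n m = {i \<in> P. rank_of P (pos m) i < n}"

text \<open>
  The rank condition puts the meeting on the boundary between the \<open>n\<close>-th and the next
  place: the two meeting particles share the rank \<open>n - 1\<close>, as ties do not count in a rank.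
\<close>

definition crossings :: "nat \<Rightarrow> real \<Rightarrow> ('i \<times> 'i) set" where
  "crossings n m = {(p, q) \<in> P \<times> P. u p < 0 \<and> 0 < u q \<and> pos m p = pos m q
     \<and> Suc (rank_of P (pos m) p) = n}"

lemma meetsI: "\<lbrakk>i \<in> P; j \<in> P; i \<noteq> j; pos m i = pos m j\<rbrakk> \<Longrightarrow> m \<in> meets"
  unfolding meets_def by auto

lemma meets_alt:
  assumes "i \<in> P" "j \<in> P" "i \<noteq> j" "pos m i = pos m j"
  shows "u i \<noteq> u j" "m = (s i - s j) / (u i - u j)"
proof -
  show "u i \<noteq> u j" using distinct[of i j] assms by (auto simp: pos_def)
  then show "m = (s i - s j) / (u i - u j)"
    using assms(4) by (simp add: pos_def field_simps)
qed

lemma crossings_empty: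
  assumes "t \<notin> meets"
  shows "crossings n t = {}"
proof (rule equals0I)
  fix x assume "x \<in> crossings n t"
  then obtain p q where "p \<in> P" "q \<in> P" "u p < 0" "0 < u q" "pos t p = pos t q"
    by (auto simp: crossings_def)
  moreover from this have "p \<noteq> q" by auto
  ultimately show False using assms by (auto simp: meets_def)
qed

lemma finite_meets: "finite meets"
proof (rule finite_subset)
  show "meets \<subseteq> (\<lambda>(i, j). (s i - s j) / (u i - u j)) ` (P \<times> P)"
    using meets_alt by (fastforce simp: meets_def)
qed (simp add: fin)

text \<open>The difference of two positions is affine in time, so it cannot change sign without a zero.\<close>

lemma meet_between:
  assumes ij: "i \<in> P" "j \<in> P" and less: "pos x i < pos x j" and nless: "\<not> pos y i < pos y j"
  obtains m where "m \<in> meets" "min x y \<le> m" "m \<le> max x y" "pos m i = pos m j"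
proof -
  define a b where "a = s i - s j" and "b = u i - u j"
  have ab: "a < x * b" "y * b \<le> a"
    using less nless by (auto simp: pos_def a_def b_def algebra_simps)
  have b: "b \<noteq> 0" using ab by auto
  define m where "m = a / b"
  have m: "m * b = a" using b by (simp add: m_def)
  have "pos m i = pos m j" using m by (simp add: pos_def a_def b_def algebra_simps)
  moreover have "i \<noteq> j" using less by auto
  moreover have "min x y \<le> m \<and> m \<le> max x y"
  proof (cases "b > 0")
    case True
    then have "m < x" "y \<le> m" using ab m
      by (metis mult_less_cancel_right_pos, metis mult_le_cancel_right_pos)
    then show ?thesis by auto
  next
    case False
    then have "b < 0" using b by auto
    then have "x < m" "m \<le> y" using ab m
      by (metis mult_less_cancel_right_neg, metis mult_le_cancel_right_neg)
    then show ?thesis by auto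
  qed
  ultimately show ?thesis using that ij by (auto simp: meets_def)
qed

lemma less_stable:
  assumes "i \<in> P" "j \<in> P" "\<And>m. m \<in> meets \<Longrightarrow> min x t \<le> m \<Longrightarrow> m \<le> max x t \<Longrightarrow> m = t"
    and "pos t i < pos t j"
  shows "pos x i < pos x j"
proof (rule ccontr)
  assume "\<not> pos x i < pos x j"
  from meet_between[OF assms(1,2,4) this] obtain m
    where "m \<in> meets" "min t x \<le> m" "m \<le> max t x" "pos m i = pos m j" .
  then show False using assms(3)[of m] assms(4) by (auto simp: min.commute max.commute)
qed

text \<open>
  If no meeting separates the time \<open>x\<close> from the time \<open>t\<close>, the order at \<open>x\<close> refines the one at
  \<open>t\<close>: particles that coincide at \<open>t\<close> are separated according to their velocities \<open>- u\<close>, the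
  one with the larger velocity being behind before \<open>t\<close> and in front after \<open>t\<close>.
\<close>

lemma rank_of_near:
  assumes "i \<in> P" "x \<noteq> t"
    and "\<And>m. m \<in> meets \<Longrightarrow> min x t \<le> m \<Longrightarrow> m \<le> max x t \<Longrightarrow> m = t"
  shows "rank_of P (pos x) i = rank_of P (pos t) i
     + card {j \<in> P. pos t j = pos t i \<and> (if x < t then u j < u i else u i < u j)}"
proof -
  have eq: "pos x j < pos x i \<longleftrightarrow> pos t j < pos t i \<or>
      (pos t j = pos t i \<and> (if x < t then u j < u i else u i < u j))" if "j \<in> P" for j
  proof (cases "pos t j = pos t i")
    case True
    have "pos x j - pos x i = (pos t j - pos t i) + (t - x) * (u j - u i)"
      by (simp add: pos_def algebra_simps)
    then have "pos x j < pos x i \<longleftrightarrow> (t - x) * (u j - u i) < 0" using True by auto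
    then show ?thesis using True assms(2) by (auto simp: mult_less_0_iff)
  next
    case False
    have "pos x j < pos x i" if "pos t j < pos t i"
      using less_stable[of j i x t] \<open>j \<in> P\<close> assms(1,3) that by blast
    moreover have "pos x i < pos x j" if "pos t i < pos t j"
      using less_stable[of i j x t] \<open>j \<in> P\<close> assms(1,3) that by blast
    ultimately show ?thesis using False by (meson less_asym linorder_neqE)
  qed
  have split: "{j \<in> P. pos x j < pos x i} = {j \<in> P. pos t j < pos t i} \<union>
      {j \<in> P. pos t j = pos t i \<and> (if x < t then u j < u i else u i < u j)}"
    using eq by blast
  show ?thesis
    unfolding rank_of_def by (subst split, rule card_Un_disjoint) (use fin in auto)
qed

text \<open>
  A particle leaves the left half at time \<open>t\<close> iff it overtakes another one in the middle, and
  then the other one enters. Hence each meeting in the middle replaces the partner \<open>p\<close>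
  of larger velocity by the other partner \<open>q\<close>, which lowers the number of right-movers in the left half iff
  \<open>p\<close> moves to the right and \<open>q\<close> to the left. The time \<open>t\<close> need not be one of a meeting; this
  also covers intervals without any meeting.
\<close>

lemma first_ranks_step:
  assumes "m1 < t" "t < m2" and only: "meets \<inter> {m1..m2} \<subseteq> {t}"
  defines "A \<equiv> {i \<in> P. u i < 0}"
  shows "card (first_ranks n m1 \<inter> A) = card (first_ranks n m2 \<inter> A) + card (crossings n t)"
proof -
  \<comment> \<open>all meetings in the middle, whatever the signs of the velocities; \<open>p\<close> overtakes \<open>q\<close>\<close>
  define M where "M = {(p, q) \<in> P \<times> P. u p < u q \<and> pos t p = pos t q
     \<and> Suc (rank_of P (pos t) p) = n}"
  define r where "r = rank_of P (pos t)"
  have r_eq: "r i = r j" if "pos t i = pos t j" for i j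
    using that by (simp add: r_def rank_of_def)
  let ?lo = "\<lambda>i. {j \<in> P. pos t j = pos t i \<and> u j < u i}"
  let ?hi = "\<lambda>i. {j \<in> P. pos t j = pos t i \<and> u i < u j}"
  have only1: "m = t" if "m \<in> meets" "min m1 t \<le> m" "m \<le> max m1 t" for m
    using that assms(1,2) only by (auto simp: subset_iff)
  have only2: "m = t" if "m \<in> meets" "min m2 t \<le> m" "m \<le> max m2 t" for m
    using that assms(1,2) only by (auto simp: subset_iff)
  have r1: "rank_of P (pos m1) i = r i + card (?lo i)" if "i \<in> P" for i
    using rank_of_near[OF that _ only1] assms(1) unfolding r_def by simp
  have r2: "rank_of P (pos m2) i = r i + card (?hi i)" if "i \<in> P" for i
    using rank_of_near[OF that _ only2] assms(2) unfolding r_def by simp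
  have uniq: "j = k" if "i \<in> P" "j \<in> P" "k \<in> P" "i \<noteq> j" "i \<noteq> k"
     "pos t j = pos t i" "pos t k = pos t i" for i j k
    using no_triple[of j i k t] that by (auto simp: pos_def)
  have lo1: "?lo i = {j}" "?hi i = {}" if "i \<in> P" "j \<in> ?lo i" for i j
    using that uniq[of i j] less_asym less_irrefl by blast+
  have hi1: "?hi i = {j}" "?lo i = {}" if "i \<in> P" "j \<in> ?hi i" for i j
    using that uniq[of i j] less_asym less_irrefl by blast+
  have 1: "first_ranks n m1 - first_ranks n m2 = fst ` M"
  proof (intro set_eqI iffI)
    fix i assume i: "i \<in> first_ranks n m1 - first_ranks n m2"
    then have iP: "i \<in> P" by (simp add: first_ranks_def)
    have n: "r i + card (?lo i) < n" "\<not> r i + card (?hi i) < n"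
      using i unfolding first_ranks_def r1[OF iP, symmetric] r2[OF iP, symmetric] by blast+
    then have "card (?hi i) \<noteq> 0" by linarith
    then have "?hi i \<noteq> {}" by (rule contrapos_nn) (simp only: card.empty)
    then obtain j where j: "j \<in> ?hi i" by blast
    have "Suc (r i) = n" using n unfolding hi1[OF iP j] by simp
    then have "(i, j) \<in> M" using iP j by (simp add: M_def r_def)
    then show "i \<in> fst ` M" by force
  next
    fix i assume "i \<in> fst ` M"
    then obtain j where M: "(i, j) \<in> M" by auto
    then have iP: "i \<in> P" and j: "j \<in> ?hi i" and n: "Suc (r i) = n" by (auto simp: M_def r_def)
    show "i \<in> first_ranks n m1 - first_ranks n m2"
      using r1[OF iP, unfolded hi1[OF iP j]] r2[OF iP, unfolded hi1[OF iP j]] iP n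
      by (simp add: first_ranks_def)
  qed
  have 2: "first_ranks n m2 - first_ranks n m1 = snd ` M"
  proof (intro set_eqI iffI)
    fix i assume i: "i \<in> first_ranks n m2 - first_ranks n m1"
    then have iP: "i \<in> P" by (simp add: first_ranks_def)
    have n: "r i + card (?hi i) < n" "\<not> r i + card (?lo i) < n"
      using i unfolding first_ranks_def r1[OF iP, symmetric] r2[OF iP, symmetric] by blast+
    then have "card (?lo i) \<noteq> 0" by linarith
    then have "?lo i \<noteq> {}" by (rule contrapos_nn) (simp only: card.empty)
    then obtain j where j: "j \<in> ?lo i" by blast
    have "Suc (r i) = n" using n unfolding lo1[OF iP j] by simp
    then have "(j, i) \<in> M" using iP j r_eq[of i j] by (simp add: M_def r_def)
    then show "i \<in> snd ` M" by force
  next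
    fix i assume "i \<in> snd ` M"
    then obtain j where M: "(j, i) \<in> M" by auto
    then have iP: "i \<in> P" and j: "j \<in> ?lo i" and n: "Suc (r i) = n"
      using r_eq[of i j] by (auto simp: M_def r_def)
    show "i \<in> first_ranks n m2 - first_ranks n m1"
      using r1[OF iP, unfolded lo1[OF iP j]] r2[OF iP, unfolded lo1[OF iP j]] iP n
      by (simp add: first_ranks_def)
  qed
  have finM: "finite M" by (rule finite_subset[of _ "P \<times> P"]) (auto simp: M_def fin)
  have inj_fst: "inj_on fst M"
  proof (rule inj_onI)
    fix x y assume xy: "x \<in> M" "y \<in> M" "fst x = fst y"
    then obtain i j k where "x = (i, j)" "y = (i, k)" by (metis prod.collapse)
    moreover from this have "j = k" using xy by (intro uniq[of i j k]) (auto simp: M_def)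
    ultimately show "x = y" by simp
  qed
  have inj_snd: "inj_on snd M"
  proof (rule inj_onI)
    fix x y assume xy: "x \<in> M" "y \<in> M" "snd x = snd y"
    then obtain i j k where "x = (j, i)" "y = (k, i)" by (metis prod.collapse)
    moreover from this have "j = k" using xy by (intro uniq[of i j k]) (auto simp: M_def)
    ultimately show "x = y" by simp
  qed
  have finL: "finite (first_ranks n m)" for m using fin by (simp add: first_ranks_def)
  \<comment> \<open>both sides count \<open>(X \<union> Y) \<inter> A\<close>\<close>
  have diff: "card (X \<inter> A) + card ((Y - X) \<inter> A) = card (Y \<inter> A) + card ((X - Y) \<inter> A)"
    if "finite X" "finite Y" for X Y
  proof -
    have "card ((X \<union> Y) \<inter> A) = card (X \<inter> A) + card ((Y - X) \<inter> A)"
      using that by (subst card_Un_disjoint[symmetric]) (auto intro: arg_cong[where f = card])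
    moreover have "card ((X \<union> Y) \<inter> A) = card (Y \<inter> A) + card ((X - Y) \<inter> A)"
      using that by (subst card_Un_disjoint[symmetric]) (auto intro: arg_cong[where f = card])
    ultimately show ?thesis by simp
  qed
  have "fst ` M \<inter> A = fst ` {x \<in> M. u (fst x) < 0}" "snd ` M \<inter> A = snd ` {x \<in> M. u (snd x) < 0}"
    by (auto simp: A_def M_def)
  then have c: "card (fst ` M \<inter> A) = card {x \<in> M. u (fst x) < 0}"
       "card (snd ` M \<inter> A) = card {x \<in> M. u (snd x) < 0}"
    using inj_fst inj_snd by (auto intro!: card_image elim: inj_on_subset)
  \<comment> \<open>\<open>u q < 0\<close> forces \<open>u p < 0\<close>, so the loss exceeds the gain by the pairs of opposite signs\<close>
  have "{x \<in> M. u (fst x) < 0} = {x \<in> M. u (snd x) < 0} \<union> crossings n t"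
    using nonzero by (force simp: M_def crossings_def)
  moreover have "{x \<in> M. u (snd x) < 0} \<inter> crossings n t = {}" by (auto simp: crossings_def)
  moreover have "finite (crossings n t)"
    by (rule finite_subset[of _ "P \<times> P"]) (auto simp: crossings_def fin)
  ultimately have "card {x \<in> M. u (fst x) < 0} = card {x \<in> M. u (snd x) < 0} + card (crossings n t)"
    using finM by (simp add: card_Un_disjoint)
  then show ?thesis using diff[OF finL finL, of m1 m2] unfolding 1 2 c by simp
qed

text \<open>Induction on the number of meetings in the interval, splitting off the first one.\<close>

lemma first_ranks_sweep:
  assumes "m1 < m2" "m1 \<notin> meets" "m2 \<notin> meets"
  defines "A \<equiv> {i \<in> P. u i < 0}"
  shows "card (first_ranks n m1 \<inter> A)
    = card (first_ranks n m2 \<inter> A) + (\<Sum>t\<in>meets \<inter> {m1..m2}. card (crossings n t))"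
  using assms(1-3)
proof (induction "card (meets \<inter> {m1..m2})" arbitrary: m1 rule: less_induct)
  case less
  let ?T = "meets \<inter> {m1..m2}"
  have finT: "finite ?T" using finite_meets by simp
  show ?case
  proof (cases "?T = {}")
    case True
    let ?t = "(m1 + m2) / 2"
    have t: "m1 < ?t" "?t < m2" using less.prems by auto
    then have "?t \<notin> meets" using True by (auto simp: disjoint_iff)
    then have "crossings n ?t = {}" by (rule crossings_empty)
    then show ?thesis using first_ranks_step[OF t, of n] True by (simp add: A_def)
  next
    case False
    define t where "t = Min ?T"
    have t: "t \<in> ?T" "\<And>m. m \<in> ?T \<Longrightarrow> t \<le> m" using Min_in[OF finT False] finT by (auto simp: t_def)
    have tm: "m1 < t" "t < m2" using t less.prems by (auto simp: order_le_less)
    \<comment> \<open>cut halfway between the first meeting and the next one, or the end if there is none\<close>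
    define N where "N = insert m2 (?T - {t})"
    define x where "x = Min N"
    have N: "finite N" "N \<noteq> {}" using finT by (auto simp: N_def)
    have x: "x \<in> N" "\<And>m. m \<in> N \<Longrightarrow> x \<le> m" using Min_in[OF N] N by (auto simp: x_def)
    have "t < x" "x \<le> m2" using x(1) x(2)[of m2] t(2) tm by (force simp: N_def order_le_less)+
    define y where "y = (t + x) / 2"
    have y: "t < y" "y < x" "y < m2" using \<open>t < x\<close> \<open>x \<le> m2\<close> by (auto simp: y_def)
    have T1: "meets \<inter> {m1..y} = {t}"
    proof
      show "meets \<inter> {m1..y} \<subseteq> {t}"
      proof
        fix m assume m: "m \<in> meets \<inter> {m1..y}"
        show "m \<in> {t}"
        proof (rule ccontr)
          assume "m \<notin> {t}"
          then have "m \<in> N" using m y by (auto simp: N_def)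
          then show False using x(2)[of m] m y by auto
        qed
      qed
    qed (use t y in auto)
    have T: "?T = insert t (meets \<inter> {y..m2})" "t \<notin> meets \<inter> {y..m2}"
    proof -
      show "?T = insert t (meets \<inter> {y..m2})"
      proof
        show "?T \<subseteq> insert t (meets \<inter> {y..m2})"
        proof
          fix m assume m: "m \<in> ?T"
          then show "m \<in> insert t (meets \<inter> {y..m2})" using x(2)[of m] y by (cases "m = t") (auto simp: N_def)
        qed
      qed (use t y tm in auto)
    qed (use y in auto)
    have yT: "y \<notin> meets" using T1 y tm by auto
    have "card (meets \<inter> {y..m2}) < card ?T"
      using finite_meets T(2) by (simp add: T(1))
    then have "card (first_ranks n y \<inter> A)
      = card (first_ranks n m2 \<inter> A) + (\<Sum>t\<in>meets \<inter> {y..m2}. card (crossings n t))"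
      using less.hyps y yT less.prems by blast
    moreover have "card (first_ranks n m1 \<inter> A) = card (first_ranks n y \<inter> A) + card (crossings n t)"
      using first_ranks_step[OF tm(1) y(1)] T1 by (simp add: A_def)
    ultimately show ?thesis using finite_meets T(2) by (simp add: T(1))
  qed
qed

lemma inj_on_pos: "m \<notin> meets \<Longrightarrow> inj_on (pos m) P"
  by (auto simp: meets_def inj_on_def)

text \<open>
  Before all meetings the particles are ordered by decreasing velocity from left to right,
  after all of them by increasing velocity.
\<close>

lemma pos_less_early:
  assumes "\<And>t. t \<in> meets \<Longrightarrow> m < t" "i \<in> P" "j \<in> P" "u i < u j"
  shows "pos m i < pos m j"
proof -
  define t where "t = (s i - s j) / (u i - u j)"
  have "t * (u i - u j) = s i - s j" using assms by (simp add: t_def)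
  then have pt: "pos t i = pos t j" by (simp add: pos_def algebra_simps)
  have "t \<in> meets" by (rule meetsI[OF assms(2,3) _ pt]) (use assms(4) in auto)
  then have "m < t" by (rule assms(1))
  then have "(t - m) * (u i - u j) < 0" using assms by (simp add: mult_less_0_iff)
  moreover have "pos m i - pos m j = (pos t i - pos t j) + (t - m) * (u i - u j)"
    by (simp add: pos_def algebra_simps)
  ultimately show ?thesis using pt by simp
qed

lemma pos_less_late:
  assumes "\<And>t. t \<in> meets \<Longrightarrow> t < m" "i \<in> P" "j \<in> P" "u i < u j"
  shows "pos m j < pos m i"
proof -
  define t where "t = (s i - s j) / (u i - u j)"
  have "t * (u i - u j) = s i - s j" using assms by (simp add: t_def)
  then have pt: "pos t i = pos t j" by (simp add: pos_def algebra_simps)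
  have "t \<in> meets" by (rule meetsI[OF assms(2,3) _ pt]) (use assms(4) in auto)
  then have "t < m" by (rule assms(1))
  then have "0 < (t - m) * (u i - u j)" using assms by (simp add: zero_less_mult_iff)
  moreover have "pos m i - pos m j = (pos t i - pos t j) + (t - m) * (u i - u j)"
    by (simp add: pos_def algebra_simps)
  ultimately show ?thesis using pt by simp
qed

text \<open>
  The number of right-movers in the left half falls from \<open>min a n\<close> to \<open>min a (n - b)\<close>, where
  \<open>a\<close> and \<open>b\<close> are the numbers of right-movers and of left-movers.
\<close>

lemma card_middle_crossings:
  assumes "card P = 2 * n"
  shows "card (\<Union>m. crossings n m) = min (card {i \<in> P. u i < 0}) (card {i \<in> P. 0 < u i})"
proof -
  define A B where "A = {i \<in> P. u i < 0}" and "B = {i \<in> P. 0 < u i}"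
  have finA: "finite A" and finB: "finite B" using fin by (auto simp: A_def B_def)
  have "P = A \<union> B" using nonzero by (force simp: A_def B_def)
  have "card (A \<union> B) = card A + card B"
    by (rule card_Un_disjoint[OF finA finB]) (auto simp: A_def B_def)
  then have cAB: "card A + card B = 2 * n"
    using assms unfolding \<open>P = A \<union> B\<close>[symmetric] by simp
  define m1 m2 where "m1 = Min (insert 0 meets) - 1" and "m2 = Max (insert 0 meets) + 1"
  have m1: "m1 < t" if "t \<in> insert 0 meets" for t
  proof -
    have "Min (insert 0 meets) \<le> t" by (rule Min_le) (use that finite_meets in auto)
    then show ?thesis by (simp add: m1_def)
  qed
  have m2: "t < m2" if "t \<in> insert 0 meets" for t
  proof -
    have "t \<le> Max (insert 0 meets)" by (rule Max_ge) (use that finite_meets in auto)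
    then show ?thesis by (simp add: m2_def)
  qed
  have m: "m1 < m2" "m1 \<notin> meets" "m2 \<notin> meets" using m1[of 0] m2[of 0] m1[of m1] m2[of m2] by auto
  have injA: "inj_on (pos m1) A" "inj_on (pos m2) A"
    using inj_on_pos m by (auto intro: inj_on_subset simp: A_def)
  \<comment> \<open>at first all left-movers are to the right of all right-movers, in the end to the left\<close>
  have early: "rank_of P (pos m1) i = rank_of A (pos m1) i" if "i \<in> A" for i
  proof -
    have "\<not> pos m1 j < pos m1 i" if "j \<in> B" for j
      using pos_less_early[of m1 i j] m1 \<open>i \<in> A\<close> that by (force simp: A_def B_def)
    then have "{j \<in> P. pos m1 j < pos m1 i} = {j \<in> A. pos m1 j < pos m1 i}"
      using \<open>P = A \<union> B\<close> by blast
    then show ?thesis by (simp add: rank_of_def)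
  qed
  have late: "rank_of P (pos m2) i = card B + rank_of A (pos m2) i" if "i \<in> A" for i
  proof -
    have "pos m2 j < pos m2 i" if "j \<in> B" for j
      using pos_less_late[of m2 i j] m2 \<open>i \<in> A\<close> that by (force simp: A_def B_def)
    then have "{j \<in> P. pos m2 j < pos m2 i} = B \<union> {j \<in> A. pos m2 j < pos m2 i}"
      using \<open>P = A \<union> B\<close> by blast
    moreover have "B \<inter> {j \<in> A. pos m2 j < pos m2 i} = {}" by (auto simp: A_def B_def)
    ultimately show ?thesis using finA finB by (simp add: rank_of_def card_Un_disjoint)
  qed
  have "first_ranks n m1 \<inter> A = {i \<in> A. rank_of A (pos m1) i < n}"
    using early by (auto simp: first_ranks_def A_def)
  then have c1: "card (first_ranks n m1 \<inter> A) = min (card A) n"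
    using card_rank_of_less[OF finA injA(1)] by simp
  have "first_ranks n m2 \<inter> A = {i \<in> A. rank_of A (pos m2) i < n - card B}"
    using late by (auto simp: first_ranks_def A_def)
  then have c2: "card (first_ranks n m2 \<inter> A) = min (card A) (n - card B)"
    using card_rank_of_less[OF finA injA(2)] by simp
  have sweep: "min (card A) n = min (card A) (n - card B) + (\<Sum>t\<in>meets. card (crossings n t))"
  proof -
    have "meets \<inter> {m1..m2} = meets" using m1 m2 by force
    then show ?thesis using first_ranks_sweep[OF m, of n] c1 c2 by (simp add: A_def)
  qed
  have sub: "crossings n t \<subseteq> P \<times> P" for t by (auto simp: crossings_def)
  have "(\<Union>t. crossings n t) = (\<Union>t\<in>meets. crossings n t)"
    using crossings_empty by blast
  also have "card \<dots> = (\<Sum>t\<in>meets. card (crossings n t))"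
  proof (rule card_UN_disjoint[OF finite_meets])
    show "\<forall>t\<in>meets. finite (crossings n t)"
      using finite_subset[OF sub] fin by simp
    show "\<forall>t\<in>meets. \<forall>t'\<in>meets. t \<noteq> t' \<longrightarrow> crossings n t \<inter> crossings n t' = {}"
    proof (intro ballI impI equals0I)
      fix t t' x assume "t \<noteq> t'" "x \<in> crossings n t \<inter> crossings n t'"
      then obtain p q where pq: "p \<in> P" "q \<in> P" "u p < 0" "0 < u q"
        "pos t p = pos t q" "pos t' p = pos t' q" by (auto simp: crossings_def)
      then have "p \<noteq> q" by auto
      then show False using meets_alt(2)[of p q t] meets_alt(2)[of p q t'] pq \<open>t \<noteq> t'\<close> by simp
    qed
  qed
  finally show ?thesis using sweep cAB unfolding A_def[symmetric] B_def[symmetric] by linarith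
qed

end

section \<open>Inversion at a point\<close>

text \<open>Each pair of points excludes at most one value of \<open>e\<close>.\<close>

lemma generic_linear_functional:
  fixes S :: "(real^2) set"
  assumes "finite S"
  obtains e where "inj_on (\<lambda>x. x $ 1 + e * x $ 2) S"
proof -
  obtain e where e: "e \<notin> (\<lambda>(x, y). (y $ 1 - x $ 1) / (x $ 2 - y $ 2)) ` (S \<times> S)"
    using ex_new_if_finite[OF infinite_UNIV_char_0] assms by (meson finite_SigmaI finite_imageI)
  have "inj_on (\<lambda>x. x $ 1 + e * x $ 2) S"
  proof (rule inj_onI)
    fix x y assume xy: "x \<in> S" "y \<in> S" "x $ 1 + e * x $ 2 = y $ 1 + e * y $ 2"
    then have eq: "e * (x $ 2 - y $ 2) = y $ 1 - x $ 1" by (simp add: algebra_simps)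
    have "x $ 2 = y $ 2"
    proof (rule ccontr)
      assume "x $ 2 \<noteq> y $ 2"
      then have "e = (y $ 1 - x $ 1) / (x $ 2 - y $ 2)" using eq by (simp add: field_simps)
      then show False using e xy by force
    qed
    then show "x = y" using eq by (simp add: vec_eq_iff forall_2)
  qed
  then show ?thesis by (rule that)
qed

locale generic_points =
  fixes S :: "(real^2) set" and e :: real
  assumes gp: "general_position S"
    and inj_height: "inj_on (\<lambda>x. x $ 1 + e * x $ 2) S"
begin

definition height :: "real^2 \<Rightarrow> real" where
  "height x = x $ 1 + e * x $ 2"

text \<open>
  In the coordinates \<open>(x $ 2, height x)\<close>, the inversion with centre \<open>v\<close> and radius 1, followed by
  the translation of \<open>v\<close> to the origin, is \<open>(inv_ord v, inv_height v)\<close>.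
\<close>

definition inv_height :: "real^2 \<Rightarrow> real^2 \<Rightarrow> real" where
  "inv_height v x = (height x - height v) / (dist x v)\<^sup>2"

definition inv_ord :: "real^2 \<Rightarrow> real^2 \<Rightarrow> real" where
  "inv_ord v x = (x $ 2 - v $ 2) / (dist x v)\<^sup>2"

text \<open>
  The centre of the circle through \<open>v\<close> that the inversion maps to the line
  \<open>s - m * u = t\<close>, for \<open>t \<noteq> 0\<close>; for \<open>t = 0\<close> the line passes through the centre of inversion
  and is its own image.
\<close>

definition centre :: "real^2 \<Rightarrow> real \<Rightarrow> real \<Rightarrow> real^2" where
  "centre v m t = v + vector [- m / (2 * t), (1 - e * m) / (2 * t)]"

lemma finite_S: "finite S"
  using gp by (simp add: general_position_def)

lemma height_inj: "x \<in> S \<Longrightarrow> y \<in> S \<Longrightarrow> height x = height y \<Longrightarrow> x = y"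
  using inj_height by (auto simp: inj_on_def height_def)

text \<open>
  The power of \<open>x\<close> with respect to the circle around \<open>c\<close> through \<open>v\<close>, divided by the squared
  distance from \<open>v\<close>, is affine in the inverted coordinates. This is why circles become lines.
\<close>

lemma power_of_point:
  assumes "x \<noteq> v"
  shows "((dist v c)\<^sup>2 - (dist x c)\<^sup>2) / (dist x v)\<^sup>2
    = 2 * ((c - v) $ 2 - e * (c - v) $ 1) * inv_ord v x
      + 2 * (c - v) $ 1 * inv_height v x - 1"
proof -
  have d: "(dist a b)\<^sup>2 = (a $ 1 - b $ 1)\<^sup>2 + (a $ 2 - b $ 2)\<^sup>2" for a b :: "real^2"
    by (simp add: dist_vec_def L2_set_def sum_2 dist_real_def)
  have "(dist v c)\<^sup>2 - (dist x c)\<^sup>2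
    = 2 * ((c - v) $ 2 - e * (c - v) $ 1) * (x $ 2 - v $ 2)
      + 2 * (c - v) $ 1 * (height x - height v) - (dist x v)\<^sup>2"
    unfolding d height_def by (simp add: power2_eq_square algebra_simps)
  moreover have "(dist x v)\<^sup>2 \<noteq> 0" using assms by simp
  moreover have "X / D = a * (y / D) + b * (z / D) - 1"
    if "X = a * y + b * z - D" "D \<noteq> 0" for X D a b y z :: real
    using that by (simp add: field_simps)
  ultimately show ?thesis unfolding inv_ord_def inv_height_def by blast
qed

lemma circle_as_line:
  assumes "x \<noteq> v" "t \<noteq> 0"
  shows "dist x (centre v m t) = dist v (centre v m t) \<longleftrightarrow> inv_ord v x - m * inv_height v x = t"
    and "dist x (centre v m t) < dist v (centre v m t) \<longleftrightarrow>
      (if 0 < t then t < inv_ord v x - m * inv_height v x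
       else inv_ord v x - m * inv_height v x < t)"
proof -
  let ?c = "centre v m t"
  let ?f = "inv_ord v x - m * inv_height v x"
  have coeff: "2 * ((?c - v) $ 2 - e * (?c - v) $ 1) = 1 / t" "2 * (?c - v) $ 1 = - m / t"
    using assms(2) by (simp_all add: centre_def field_simps)
  have "((dist v ?c)\<^sup>2 - (dist x ?c)\<^sup>2) / (dist x v)\<^sup>2 = (?f - t) / t"
    unfolding power_of_point[OF assms(1)] coeff using assms(2) by (simp add: field_simps)
  moreover have D: "(dist x v)\<^sup>2 > 0" using assms(1) by simp
  ultimately have eq: "(dist v ?c)\<^sup>2 - (dist x ?c)\<^sup>2 = (?f - t) / t * (dist x v)\<^sup>2"
    by (simp add: field_simps)
  have "dist x ?c = dist v ?c \<longleftrightarrow> (dist v ?c)\<^sup>2 - (dist x ?c)\<^sup>2 = 0"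
    by auto
  also have "\<dots> \<longleftrightarrow> ?f = t" unfolding eq using D assms by simp
  finally show "dist x ?c = dist v ?c \<longleftrightarrow> ?f = t" .
  have "dist x ?c < dist v ?c \<longleftrightarrow> 0 < (dist v ?c)\<^sup>2 - (dist x ?c)\<^sup>2"
    by (auto intro: power_strict_mono power2_less_imp_less)
  also have "\<dots> \<longleftrightarrow> 0 < (?f - t) / t" unfolding eq using D zero_less_mult_pos2 mult_pos_pos by blast
  also have "\<dots> \<longleftrightarrow> (if 0 < t then t < ?f else ?f < t)"
    using assms(2) by (simp add: zero_less_divide_iff)
  finally show "dist x ?c < dist v ?c \<longleftrightarrow> (if 0 < t then t < ?f else ?f < t)" .
qed

lemma inv_height_sign:
  "inv_height v x < 0 \<longleftrightarrow> height x < height v" "0 < inv_height v x \<longleftrightarrow> height v < height x"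
  by (cases "x = v"; simp add: inv_height_def divide_less_0_iff zero_less_divide_iff)+

text \<open>
  A circle through \<open>v\<close>, a lower point and a higher point is not mapped to a horizontal line, so
  the parametrisation of lines by \<open>m\<close> and \<open>t\<close> reaches it.
\<close>

lemma centre_surj:
  assumes "inv_height v p < 0" "0 < inv_height v q" "dist p c = dist v c" "dist q c = dist v c"
  obtains m t where "t \<noteq> 0" "c = centre v m t"
proof -
  define a b where "a = 2 * ((c - v) $ 2 - e * (c - v) $ 1)" and "b = 2 * (c - v) $ 1"
  have ne: "p \<noteq> v" "q \<noteq> v" using assms(1,2) by (auto simp: inv_height_def)
  have p: "a * inv_ord v p + b * inv_height v p = 1" and q: "a * inv_ord v q + b * inv_height v q = 1"
    using power_of_point[OF ne(1), of c] power_of_point[OF ne(2), of c] assms(3,4)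
    by (simp_all add: a_def b_def)
  have "a \<noteq> 0"
  proof
    assume "a = 0"
    then have "0 < b * inv_height v p" "0 < b * inv_height v q" using p q by auto
    then show False using assms(1,2) by (auto simp: zero_less_mult_iff)
  qed
  moreover have "c = centre v (- b / a) (1 / a)"
    using \<open>a \<noteq> 0\<close> unfolding centre_def
    by (simp add: vec_eq_iff forall_2 add_divide_distrib diff_divide_distrib)
       (simp add: a_def b_def field_simps)
  ultimately show ?thesis by (intro that[of "1 / a" "- b / a"]) auto
qed

lemma not_on_line_through_origin:
  assumes "v \<in> S" "x \<in> S" "y \<in> S" "v \<noteq> x" "v \<noteq> y" "x \<noteq> y"
    and "inv_ord v x = m * inv_height v x" "inv_ord v y = m * inv_height v y"
  shows False
proof -
  \<comment> \<open>the direction of height 1 and second coordinate \<open>m\<close>\<close>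
  define w :: "real^2" where "w = vector [1 - e * m, m]"
  have on: "z = v + (height z - height v) *\<^sub>R w"
    if "z \<noteq> v" "inv_ord v z = m * inv_height v z" for z
  proof -
    have z2: "m * (height z - height v) = z $ 2 - v $ 2"
      using that by (simp add: inv_ord_def inv_height_def)
    have "(height z - height v) * (1 - e * m)
        = (height z - height v) - e * (m * (height z - height v))"
      by (simp add: algebra_simps)
    also have "\<dots> = z $ 1 - v $ 1" unfolding z2 by (simp add: height_def algebra_simps)
    finally show ?thesis
      using z2 by (simp add: vec_eq_iff forall_2 w_def mult.commute)
  qed
  have "collinear {v, x, y}"
    unfolding collinear_def
  proof (intro exI ballI)
    fix a b assume "a \<in> {v, x, y}" "b \<in> {v, x, y}"
    then have "a = v + (height a - height v) *\<^sub>R w" "b = v + (height b - height v) *\<^sub>R w"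
      using on[of x] on[of y] assms(4-8) by auto
    then have "a - b = (height a - height v) *\<^sub>R w - (height b - height v) *\<^sub>R w"
      by (metis add_diff_cancel_left)
    then show "a - b = (height a - height b) *\<^sub>R w" by (simp add: algebra_simps)
  qed
  moreover have "card {v, x, y} = 3" using assms(4-6) by simp
  ultimately show False using gp assms(1-3) unfolding general_position_def by (metis empty_subsetI insert_subset)
qed

text \<open>A line through three inverted points yields four concyclic or three collinear points of \<open>S\<close>.\<close>

lemma not_three_on_line:
  assumes "v \<in> S" "x \<in> S" "y \<in> S" "z \<in> S" "v \<noteq> x" "v \<noteq> y" "v \<noteq> z" "x \<noteq> y" "y \<noteq> z" "x \<noteq> z"
    and f: "inv_ord v x - m * inv_height v x = t" "inv_ord v y - m * inv_height v y = t"
      "inv_ord v z - m * inv_height v z = t"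
  shows False
proof (cases "t = 0")
  case True
  then show False using not_on_line_through_origin[of v x y m] assms by simp
next
  case False
  define c where "c = centre v m t"
  have "dist x c = dist v c" "dist y c = dist v c" "dist z c = dist v c"
    unfolding c_def using circle_as_line(1)[OF _ False] f assms(5-7) by auto
  then have sub: "{v, x, y, z} \<subseteq> sphere c (dist v c)"
    by (simp add: dist_commute)
  have "dist v c > 0"
  proof -
    have "v \<noteq> c" using \<open>dist x c = dist v c\<close> assms(5) by auto
    then show ?thesis by simp
  qed
  then have "concyclic {v, x, y, z}" using sub unfolding concyclic_def by blast
  moreover have "card {v, x, y, z} = 4" using assms(5-10) by simp
  moreover have "{v, x, y, z} \<subseteq> S" using assms by simp
  ultimately show False using gp unfolding general_position_def by blast
qed

lemma particles:
  assumes v: "v \<in> S"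
  shows "particles (S - {v}) (inv_ord v) (inv_height v)"
proof
  show "finite (S - {v})" using finite_S by simp
next
  fix i assume "i \<in> S - {v}"
  then have "height i \<noteq> height v" using height_inj v by auto
  then show nz: "inv_height v i \<noteq> 0" using inv_height_sign[of v i] by linarith
  fix j assume j: "j \<in> S - {v}" "i \<noteq> j" "inv_height v i = inv_height v j"
  show "inv_ord v i \<noteq> inv_ord v j"
  proof
    assume eq: "inv_ord v i = inv_ord v j"
    define m where "m = inv_ord v i / inv_height v i"
    have "inv_ord v i = m * inv_height v i" "inv_ord v j = m * inv_height v j"
      using nz eq j(3) by (simp_all add: m_def)
    then show False
      using not_on_line_through_origin[of v i j m] v j \<open>i \<in> S - {v}\<close> by auto
  qed
next
  fix i j k m
  assume "i \<in> S - {v}" "j \<in> S - {v}" "k \<in> S - {v}" "i \<noteq> j" "j \<noteq> k" "i \<noteq> k"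
    "inv_ord v i - m * inv_height v i = inv_ord v j - m * inv_height v j"
  then show "inv_ord v k - m * inv_height v k \<noteq> inv_ord v j - m * inv_height v j"
    using not_three_on_line[OF v, of i j k m] by auto
qed

definition halving_pairs :: "nat \<Rightarrow> real^2 \<Rightarrow> ((real^2) \<times> (real^2)) set" where
  "halving_pairs n v = (\<Union>m. particles.crossings (S - {v}) (inv_ord v) (inv_height v) n m)"

lemma halving_pairsD:
  assumes "v \<in> S" "(p, q) \<in> halving_pairs n v"
  shows "p \<in> S" "q \<in> S" "height p < height v" "height v < height q"
proof -
  interpret particles "S - {v}" "inv_ord v" "inv_height v" by (rule particles[OF assms(1)])
  show "p \<in> S" "q \<in> S" "height p < height v" "height v < height q"
    using assms(2) by (auto simp: halving_pairs_def crossings_def inv_height_sign)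
qed

lemma card_halving_pairs:
  assumes "v \<in> S" "card S = 2 * n + 1"
  shows "card (halving_pairs n v) = min (rank_of S height v) (2 * n - rank_of S height v)"
proof -
  interpret particles "S - {v}" "inv_ord v" "inv_height v" by (rule particles[OF assms(1)])
  have "card (S - {v}) = 2 * n" using assms finite_S by simp
  then have "card (halving_pairs n v)
      = min (card {x \<in> S - {v}. inv_height v x < 0}) (card {x \<in> S - {v}. 0 < inv_height v x})"
    unfolding halving_pairs_def by (rule card_middle_crossings)
  moreover have "{x \<in> S - {v}. inv_height v x < 0} = {x \<in> S. height x < height v}"
    "{x \<in> S - {v}. 0 < inv_height v x} = {x \<in> S. height v < height x}"
    by (auto simp: inv_height_sign)
  moreover have "card {x \<in> S. height v < height x} = 2 * n - card {x \<in> S. height x < height v}"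
  proof -
    have "S - {v} = {x \<in> S. height x < height v} \<union> {x \<in> S. height v < height x}"
      using height_inj assms(1) by (auto simp: not_less_iff_gr_or_eq)
    then have "card (S - {v}) = card ({x \<in> S. height x < height v} \<union> {x \<in> S. height v < height x})"
      by (rule arg_cong)
    also have "\<dots> = card {x \<in> S. height x < height v} + card {x \<in> S. height v < height x}"
      using finite_S by (intro card_Un_disjoint) auto
    finally show ?thesis using \<open>card (S - {v}) = 2 * n\<close> by simp
  qed
  ultimately show ?thesis by (simp add: rank_of_def)
qed

text \<open>
  Let \<open>s - m * u = t\<close> be the line through the images of \<open>p\<close> and \<open>q\<close>. The interior of the circle
  becomes \<open>t < s - m * u\<close> or \<open>s - m * u < t\<close>, depending on the sign of \<open>t\<close>. The sign
  makes no difference, because \<open>n - 1\<close> of the other \<open>2 * n - 2\<close> points on one side leave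
  \<open>n - 1\<close> on the other.
\<close>

lemma halving_pairs_iff:
  assumes S: "v \<in> S" "p \<in> S" "q \<in> S" and h: "height p < height v" "height v < height q"
    and n: "n \<ge> 1" "card S = 2 * n + 1"
  shows "(p, q) \<in> halving_pairs n v \<longleftrightarrow>
    (\<exists>c. S \<inter> sphere c (dist v c) = {v, p, q} \<and> card (S \<inter> ball c (dist v c)) = n - 1)"
proof -
  let ?P = "S - {v}"
  interpret particles ?P "inv_ord v" "inv_height v" by (rule particles[OF S(1)])
  have P: "p \<in> ?P" "q \<in> ?P" "p \<noteq> q" "inv_height v p < 0" "0 < inv_height v q"
    using S h by (auto simp: inv_height_sign)
  have cP: "card ?P = 2 * n" using n S finite_S by simp
  have circ: "S \<inter> sphere (centre v m t) (dist v (centre v m t)) = insert v {x \<in> ?P. pos m x = t}"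
    "S \<inter> ball (centre v m t) (dist v (centre v m t))
       = (if 0 < t then {x \<in> ?P. t < pos m x} else {x \<in> ?P. pos m x < t})" if "t \<noteq> 0" for m t
  proof -
    let ?c = "centre v m t"
    have "x \<in> S \<inter> sphere ?c (dist v ?c) \<longleftrightarrow> x \<in> insert v {x \<in> ?P. pos m x = t}" for x
      using circle_as_line(1)[OF _ that, of x v m] S(1)
      by (cases "x = v") (auto simp: pos_def dist_commute)
    then show "S \<inter> sphere ?c (dist v ?c) = insert v {x \<in> ?P. pos m x = t}" by blast
    have "x \<in> S \<inter> ball ?c (dist v ?c) \<longleftrightarrow>
        x \<in> (if 0 < t then {x \<in> ?P. t < pos m x} else {x \<in> ?P. pos m x < t})" for x
      using circle_as_line(2)[OF _ that, of x v m]
      by (cases "x = v") (auto simp: pos_def dist_commute)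
    then show "S \<inter> ball ?c (dist v ?c)
        = (if 0 < t then {x \<in> ?P. t < pos m x} else {x \<in> ?P. pos m x < t})" by blast
  qed
  have split: "card {x \<in> ?P. pos m x < t} + card {x \<in> ?P. pos m x = t}
      + card {x \<in> ?P. t < pos m x} = 2 * n" for m t
  proof -
    have "?P = {x \<in> ?P. pos m x < t} \<union> ({x \<in> ?P. pos m x = t} \<union> {x \<in> ?P. t < pos m x})"
      by auto
    then have "card ?P = card ({x \<in> ?P. pos m x < t} \<union> ({x \<in> ?P. pos m x = t} \<union> {x \<in> ?P. t < pos m x}))"
      by (rule arg_cong)
    also have "\<dots> = card {x \<in> ?P. pos m x < t} +
        card ({x \<in> ?P. pos m x = t} \<union> {x \<in> ?P. t < pos m x})"
      using fin by (intro card_Un_disjoint) auto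
    also have "card ({x \<in> ?P. pos m x = t} \<union> {x \<in> ?P. t < pos m x})
      = card {x \<in> ?P. pos m x = t} + card {x \<in> ?P. t < pos m x}"
      using fin by (intro card_Un_disjoint) auto
    finally show ?thesis using cP by simp
  qed
  have cpq: "card {p, q} = 2" using P by simp
  show ?thesis
  proof
    assume "(p, q) \<in> halving_pairs n v"
    then obtain m where m: "(p, q) \<in> crossings n m" by (auto simp: halving_pairs_def)
    define t where "t = pos m p"
    have t: "pos m p = t" "pos m q = t" and r: "Suc (card {x \<in> ?P. pos m x < t}) = n"
      using m by (auto simp: crossings_def t_def rank_of_def)
    have E: "{x \<in> ?P. pos m x = t} = {p, q}"
      using not_three_on_line[of v p q _ m t] t P S by (auto simp: pos_def)
    have "t \<noteq> 0"
      using not_on_line_through_origin[of v p q m] t P S by (auto simp: pos_def)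
    moreover have "card {x \<in> ?P. t < pos m x} = n - 1"
      using split[of m t] r unfolding E cpq by linarith
    ultimately show "\<exists>c. S \<inter> sphere c (dist v c) = {v, p, q} \<and> card (S \<inter> ball c (dist v c)) = n - 1"
      using circ[of t m] E r by (intro exI[of _ "centre v m t"]) auto
  next
    assume "\<exists>c. S \<inter> sphere c (dist v c) = {v, p, q} \<and> card (S \<inter> ball c (dist v c)) = n - 1"
    then obtain c where c: "S \<inter> sphere c (dist v c) = {v, p, q}" "card (S \<inter> ball c (dist v c)) = n - 1"
      by blast
    have "p \<in> sphere c (dist v c)" "q \<in> sphere c (dist v c)" using c(1) by blast+
    then have "dist p c = dist v c" "dist q c = dist v c" by (auto simp: dist_commute)
    then obtain m t where t: "t \<noteq> 0" "c = centre v m t" using centre_surj P(4,5) by blast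
    have E: "{x \<in> ?P. pos m x = t} = {p, q}"
      using c(1) P unfolding t(2) circ(1)[OF t(1)] by auto
    have "card (if 0 < t then {x \<in> ?P. t < pos m x} else {x \<in> ?P. pos m x < t}) = n - 1"
      using c(2) unfolding t(2) circ(2)[OF t(1)] .
    then have "card {x \<in> ?P. pos m x < t} = n - 1"
      using split[of m t] n(1) unfolding E cpq by (cases "0 < t") auto
    moreover have "pos m p = t" "pos m q = t" using E by blast+
    ultimately have "(p, q) \<in> crossings n m"
      using P n(1) by (auto simp: crossings_def rank_of_def)
    then show "(p, q) \<in> halving_pairs n v" by (auto simp: halving_pairs_def)
  qed
qed

lemma sorted_triple:
  assumes "card T = 3" "T \<subseteq> S"
  obtains p v q where "T = {v, p, q}" "height p < height v" "height v < height q"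
proof -
  have *: "\<exists>p v q. T = {v, p, q} \<and> height p < height v \<and> height v < height q"
    if T: "T = {x, y, z}" and h: "height x < height y" "height x < height z" "height y \<noteq> height z" for x y z
  proof (cases "height y < height z")
    case True
    then have "T = {y, x, z} \<and> height x < height y \<and> height y < height z" using T h by auto
    then show ?thesis by blast
  next
    case False
    then have "T = {z, x, y} \<and> height x < height z \<and> height z < height y" using T h by auto
    then show ?thesis by blast
  qed
  obtain x y z where T: "T = {x, y, z}" "x \<noteq> y" "y \<noteq> z" "x \<noteq> z"
    using assms(1) by (auto simp: card_3_iff)
  then have h: "height x \<noteq> height y" "height y \<noteq> height z" "height x \<noteq> height z"
    using height_inj assms(2) by auto
  have eqs: "T = {y, x, z}" "T = {z, x, y}" using T(1) by auto
  consider "height x < height y" "height x < height z" | "height y < height x" "height y < height z"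
    | "height z < height x" "height z < height y"
    using h by linarith
  then have "\<exists>p v q. T = {v, p, q} \<and> height p < height v \<and> height v < height q"
    using *[OF T(1)] *[OF eqs(1)] *[OF eqs(2)] h by cases auto
  then show ?thesis using that by blast
qed

text \<open>
  Points with the same distances from \<open>c\<close> and from \<open>c'\<close> differ by vectors perpendicular to
  \<open>c' - c\<close>, which are parallel to each other if \<open>c \<noteq> c'\<close>.
\<close>

lemma circle_determined:
  assumes "card (S \<inter> sphere c r) = 3" "S \<inter> sphere c r = S \<inter> sphere c' r'"
  shows "sphere c r = sphere c' r'"
proof -
  let ?T = "S \<inter> sphere c r"
  have nc: "\<not> collinear ?T" using gp assms(1) by (simp add: general_position_def)
  have on: "dist x c = r" "dist x c' = r'" if "x \<in> ?T" for x
    using that assms(2) by (auto simp: dist_commute)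
  have "c = c'"
  proof (rule ccontr)
    assume "c \<noteq> c'"
    define a b where "a = c' $ 1 - c $ 1" and "b = c' $ 2 - c $ 2"
    have "a \<noteq> 0 \<or> b \<noteq> 0" using \<open>c \<noteq> c'\<close> by (auto simp: a_def b_def vec_eq_iff forall_2)
    then have ab: "a\<^sup>2 + b\<^sup>2 \<noteq> 0" by (simp add: sum_power2_eq_zero_iff)
    have d: "(dist x y)\<^sup>2 = (x $ 1 - y $ 1)\<^sup>2 + (x $ 2 - y $ 2)\<^sup>2" for x y :: "real^2"
      by (simp add: dist_vec_def L2_set_def sum_2 dist_real_def)
    have "collinear ?T"
      unfolding collinear_def
    proof (intro exI ballI)
      fix x y assume xy: "x \<in> ?T" "y \<in> ?T"
      define X Y where "X = x $ 1 - y $ 1" and "Y = x $ 2 - y $ 2"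
      have "(dist x c)\<^sup>2 - (dist x c')\<^sup>2 = (dist y c)\<^sup>2 - (dist y c')\<^sup>2"
        using on xy by simp
      then have perp: "a * X + b * Y = 0"
        unfolding d a_def b_def X_def Y_def by (simp add: power2_eq_square algebra_simps)
      \<comment> \<open>\<open>(X, Y)\<close> is perpendicular to \<open>(a, b)\<close>, and \<open>k\<close> is its coordinate along \<open>(- b, a)\<close>\<close>
      define k where "k = (a * Y - b * X) / (a\<^sup>2 + b\<^sup>2)"
      have "(a\<^sup>2 + b\<^sup>2) * X = - b * (a * Y - b * X) + a * (a * X + b * Y)"
        "(a\<^sup>2 + b\<^sup>2) * Y = a * (a * Y - b * X) + b * (a * X + b * Y)"
        by (simp_all add: power2_eq_square algebra_simps)
      then have "X = k * (- b)" "Y = k * a"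
        using ab unfolding perp by (simp_all add: k_def field_simps)
      then show "x - y = k *\<^sub>R vector [- b, a]"
        by (simp add: vec_eq_iff forall_2 X_def Y_def)
    qed
    then show False using nc by simp
  qed
  moreover have "r = r'"
  proof -
    have "?T \<noteq> {}" using assms(1) by force
    then obtain x where "x \<in> ?T" by blast
    then have "dist x c = r" "dist x c' = r'" by (rule on)+
    then show ?thesis using \<open>c = c'\<close> by simp
  qed
  ultimately show ?thesis by simp
qed

lemma card_outside:
  assumes "card S = 2 * n + 1" "n \<ge> 1" "card (S \<inter> sphere c r) = 3" "card (S \<inter> ball c r) = n - 1"
  shows "card (S - cball c r) = n - 1"
proof -
  have "S \<inter> cball c r = (S \<inter> ball c r) \<union> (S \<inter> sphere c r)" by auto
  moreover have "card ((S \<inter> ball c r) \<union> (S \<inter> sphere c r)) = card (S \<inter> ball c r) + card (S \<inter> sphere c r)"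
    using finite_S by (intro card_Un_disjoint) auto
  ultimately have "card (S \<inter> cball c r) = n + 2" using assms by simp
  then show ?thesis using card_Diff_subset_Int[of S "cball c r"] finite_S assms(1) by simp
qed

lemma triples_of_point_splitting_circles:
  assumes n: "n \<ge> 1" "card S = 2 * n + 1"
  shows "(\<lambda>C. S \<inter> C) ` {C. point_splitting n S C}
    = (\<lambda>(v, p, q). {v, p, q}) ` (SIGMA v:S. halving_pairs n v)"
proof (intro equalityI subsetI)
  fix T assume "T \<in> (\<lambda>C. S \<inter> C) ` {C. point_splitting n S C}"
  then obtain c r where T: "T = S \<inter> sphere c r" "card T = 3" "card (S \<inter> ball c r) = n - 1"
    by (auto simp: point_splitting_def)
  have "T \<subseteq> S" using T(1) by simp
  with T(2) obtain p v q where pvq: "T = {v, p, q}" "height p < height v" "height v < height q"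
    by (rule sorted_triple)
  have "v \<in> sphere c r" using T(1) pvq(1) by blast
  then have r: "r = dist v c" by (simp add: dist_commute)
  have "v \<in> S" "p \<in> S" "q \<in> S" using \<open>T \<subseteq> S\<close> pvq(1) by auto
  moreover have "(p, q) \<in> halving_pairs n v"
    unfolding halving_pairs_iff[OF \<open>v \<in> S\<close> \<open>p \<in> S\<close> \<open>q \<in> S\<close> pvq(2,3) n]
    using T(1,3) unfolding r pvq(1) by (intro exI[of _ c]) simp
  ultimately show "T \<in> (\<lambda>(v, p, q). {v, p, q}) ` (SIGMA v:S. halving_pairs n v)"
    using pvq(1) by force
next
  fix T assume "T \<in> (\<lambda>(v, p, q). {v, p, q}) ` (SIGMA v:S. halving_pairs n v)"
  then obtain v p q where T: "T = {v, p, q}" "v \<in> S" "(p, q) \<in> halving_pairs n v" by auto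
  note pq = halving_pairsD[OF T(2,3)]
  obtain c where c: "S \<inter> sphere c (dist v c) = {v, p, q}" "card (S \<inter> ball c (dist v c)) = n - 1"
    using halving_pairs_iff[OF T(2) pq n] T(3) by blast
  have "v \<noteq> p" "v \<noteq> q" "p \<noteq> q" using pq(3,4) by auto
  then have three: "card (S \<inter> sphere c (dist v c)) = 3" unfolding c(1) by simp
  have "dist v c > 0"
  proof -
    have "p \<in> sphere c (dist v c)" using c(1) by blast
    then have "v \<noteq> c" using pq(3) by auto
    then show ?thesis by simp
  qed
  then have "point_splitting n S (sphere c (dist v c))"
    unfolding point_splitting_def
    using three c(2) card_outside[OF n(2,1) three c(2)]
    by (intro exI[of _ c] exI[of _ "dist v c"] conjI) simp_all
  then show "T \<in> (\<lambda>C. S \<inter> C) ` {C. point_splitting n S C}"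
    unfolding T(1) c(1)[symmetric] by (intro imageI) simp
qed

text \<open>
  A point-splitting circle is determined by its three points in \<open>S\<close>, and these by their middle
  point and the pair of the other two, so circles correspond to pairs halving at some \<open>v\<close>.
\<close>

lemma card_point_splitting:
  assumes n: "n \<ge> 1" "card S = 2 * n + 1"
  shows "card {C. point_splitting n S C} = n\<^sup>2"
proof -
  have inj_circ: "inj_on (\<lambda>C. S \<inter> C) {C. point_splitting n S C}"
  proof (rule inj_onI)
    fix C C' assume "C \<in> {C. point_splitting n S C}" "C' \<in> {C. point_splitting n S C}"
      and eq: "S \<inter> C = S \<inter> C'"
    then obtain c r c' r' where "C = sphere c r" "C' = sphere c' r'" "card (S \<inter> sphere c r) = 3"
      unfolding point_splitting_def by blast
    then show "C = C'" using circle_determined eq by blast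
  qed
  have inj_triple: "inj_on (\<lambda>(v, p, q). {v, p, q}) (SIGMA v:S. halving_pairs n v)"
  proof (rule inj_onI)
    fix x y
    assume x: "x \<in> (SIGMA v:S. halving_pairs n v)" and y: "y \<in> (SIGMA v:S. halving_pairs n v)"
      and xy: "(\<lambda>(v, p, q). {v, p, q}) x = (\<lambda>(v, p, q). {v, p, q}) y"
    obtain v p q where x': "x = (v, p, q)" by (cases x)
    obtain v' p' q' where y': "y = (v', p', q')" by (cases y)
    have eq: "{v, p, q} = {v', p', q'}" using xy by (simp add: x' y')
    have "v \<in> S" "(p, q) \<in> halving_pairs n v" "v' \<in> S" "(p', q') \<in> halving_pairs n v'"
      using x y by (simp_all add: x' y')
    then have h: "height p < height v" "height v < height q" "height p' < height v'" "height v' < height q'"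
      by (blast intro: halving_pairsD)+
    have "v \<in> {v', p', q'}" "p \<in> {v', p', q'}" "q \<in> {v', p', q'}"
      "v' \<in> {v, p, q}" "p' \<in> {v, p, q}" "q' \<in> {v, p, q}"
      using eq by blast+
    then have "v = v' \<and> p = p' \<and> q = q'" using h by auto
    then show "x = y" by (simp add: x' y')
  qed
  have fin: "finite (halving_pairs n v)" if "v \<in> S" for v
  proof (rule finite_subset)
    show "halving_pairs n v \<subseteq> S \<times> S" using halving_pairsD[OF that] by auto
  qed (simp add: finite_S)
  have "card {C. point_splitting n S C} = card ((\<lambda>C. S \<inter> C) ` {C. point_splitting n S C})"
    by (rule card_image[OF inj_circ, symmetric])
  also have "\<dots> = card (SIGMA v:S. halving_pairs n v)"
    unfolding triples_of_point_splitting_circles[OF n] by (rule card_image[OF inj_triple])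
  also have "\<dots> = (\<Sum>v\<in>S. card (halving_pairs n v))"
    using finite_S fin by simp
  also have "\<dots> = (\<Sum>v\<in>S. min (rank_of S height v) (2 * n - rank_of S height v))"
    using card_halving_pairs n(2) by simp
  also have "\<dots> = (\<Sum>k<2 * n + 1. min k (2 * n - k))"
    using sum_rank_of[OF finite_S, of height "\<lambda>k. min k (2 * n - k)"] height_inj n(2)
    by (simp add: inj_on_def)
  also have "\<dots> = n\<^sup>2" by (rule sum_min_symmetric)
  finally show ?thesis .
qed

end

theorem theorem1p3:
  fixes n :: nat and S :: "(real^2) set"
  assumes "n \<ge> 1"
    and "general_position S"
    and "card S = 2 * n + 1"
  shows "card {C. point_splitting n S C} = n\<^sup>2"
proof -
  have "finite S" using assms(2) by (simp add: general_position_def)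
  then obtain e where "inj_on (\<lambda>x. x $ 1 + e * x $ 2) S" by (rule generic_linear_functional)
  then interpret generic_points S e using assms(2) by unfold_locales
  show ?thesis using card_point_splitting assms(1,3) .
qed

end
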